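(* Let $l>0$ and $p>1$. There exists $\lambda_*>0$ such that the problem \[ u''+\lambda|x|^l(u+1)^p=0,\ x\in(-1,1),\qquad u(-1)=u(1)=0 \] has exactly two positive even solutions for $0<\lambda<\lambda_*$, a unique positive even solution for $\lambda=\lambda_*$, and no positive even solution for $\lambda>\lambda_*$.
   Context: Solutions are classical. A solution is positive if $u(x)>0$ for $x\in(-1,1)$, and even if $u(-x)=u(x)$. *)

theory Defs
  imports "HOL-Analysis.Analysis"
begin

text \<open>A classical solution belongs to \<open>C\<^sup>2(-1,1) \<inter> C[-1,1]\<close>. The functions \<open>u'\<close> and \<open>u''\<close> below are
  the first and second derivatives of \<open>u\<close> on the open interval. The base \<open>u x + 1\<close> of the real
  power is positive for the positive solutions considered here.\<close>

definition classical_solution :: "real \<Rightarrow> real \<Rightarrow> real \<Rightarrow> (real \<Rightarrow> real) \<Rightarrow> bool" where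
  "classical_solution l p lam u \<longleftrightarrow>
     continuous_on {-1..1} u \<and>
     (\<exists>u' u''.
        (\<forall>x\<in>{-1<..<1}. (u has_real_derivative u' x) (at x)) \<and>
        (\<forall>x\<in>{-1<..<1}. (u' has_real_derivative u'' x) (at x)) \<and>
        continuous_on {-1<..<1} u'' \<and>
        (\<forall>x\<in>{-1<..<1}. u'' x + lam * \<bar>x\<bar> powr l * (u x + 1) powr p = 0)) \<and>
     u (-1) = 0 \<and> u 1 = 0"

definition positive_solution :: "real \<Rightarrow> real \<Rightarrow> real \<Rightarrow> (real \<Rightarrow> real) \<Rightarrow> bool" where
  "positive_solution l p lam u \<longleftrightarrow>
     classical_solution l p lam u \<and> (\<forall>x\<in>{-1<..<1}. 0 < u x)"

text \<open>Solutions are functions on \<open>[-1,1]\<close> only. Membership in \<open>extensional {-1..1}\<close> fixes the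
  irrelevant values outside the interval, so that each solution on \<open>[-1,1]\<close> is counted once.\<close>

definition positive_even_solutions :: "real \<Rightarrow> real \<Rightarrow> real \<Rightarrow> (real \<Rightarrow> real) set" where
  "positive_even_solutions l p lam =
     {u \<in> extensional {-1..1}. positive_solution l p lam u \<and> (\<forall>x\<in>{-1..1}. u (-x) = u x)}"

end

theory Submission
  imports Defs
begin

text \<open>Let \<open>w\<close> solve \<open>w'' + r\<^sup>l w\<^sup>p = 0\<close>, \<open>w 0 = 1\<close>, \<open>w' 0 = 0\<close>, up to its first zero \<open>R\<close>, which is finite by
  concavity. By scaling and uniqueness for the initial value problem, the positive even solutions
  are the functions \<open>u x = w (b \<bar>x\<bar>) / w b - 1\<close> with \<open>0 < b < R\<close>, and \<open>u\<close> belongs to the parameter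
  \<open>\<lambda> = b\<^bsup>l+2\<^esup> (w b)\<^bsup>p-1\<^esup>\<close>. As a function of \<open>b\<close> this vanishes at \<open>0\<close> and \<open>R\<close>, and the sign of its derivative
  is that of \<open>(l + 2) w b + (p - 1) b w' b\<close>, which is strictly decreasing because \<open>w'\<close> and \<open>w''\<close> are negative.
  So \<open>\<lambda>\<close> first increases and then decreases, and its maximum is the critical value.\<close>

section \<open>Second-order initial value problems\<close>

text \<open>The mean value theorem expresses the increment through \<open>p * z powr (p - 1)\<close>
  at an interior point. Interior points are positive, so the derivative formula applies even if the
  interval starts at 0, where only continuity is used.\<close>

lemma powr_lipschitz_on_Icc:
  fixes p M x y :: real
  assumes "1 \<le> p" "x \<in> {0..M}" "y \<in> {0..M}"
  shows "\<bar>x powr p - y powr p\<bar> \<le> p * M powr (p - 1) * \<bar>x - y\<bar>"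
proof -
  have main: "\<bar>y powr p - x powr p\<bar> \<le> p * M powr (p - 1) * \<bar>y - x\<bar>"
    if "0 \<le> x" "x < y" "y \<le> M" for x y
  proof -
    have "\<exists>l z. x < z \<and> z < y \<and> ((\<lambda>z. z powr p) has_real_derivative l) (at z)
        \<and> y powr p - x powr p = (y - x) * l"
    proof (rule MVT[OF \<open>x < y\<close>])
      show "continuous_on {x..y} (\<lambda>z. z powr p)"
        using that assms by (intro continuous_on_powr') (auto intro!: continuous_intros)
      show "(\<lambda>z. z powr p) differentiable (at z)" if "x < z" "z < y" for z
        using has_real_derivative_powr[of z p] that \<open>0 \<le> x\<close>
        unfolding real_differentiable_def by force
    qed
    then obtain k z where z: "x < z" "z < y" "((\<lambda>z. z powr p) has_real_derivative k) (at z)"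
      "y powr p - x powr p = (y - x) * k" by blast
    have k: "k = p * z powr (p - 1)"
      using z has_real_derivative_powr[of z p] that by (intro DERIV_unique[OF z(3)]) auto
    have "z powr (p - 1) \<le> M powr (p - 1)"
      using z that assms by (intro powr_mono2) auto
    then have "0 \<le> k" "k \<le> p * M powr (p - 1)"
      unfolding k using assms by (auto intro!: mult_left_mono)
    then show ?thesis
      unfolding z(4) abs_mult using that by (simp add: mult.commute mult_right_mono)
  qed
  show ?thesis
    using main[of x y] main[of y x] assms
    by (cases x y rule: linorder_cases) (auto simp: abs_minus_commute)
qed

text \<open>One integration gains the factor \<open>1 / K\<close> against the weight
  \<open>exp (K * s)\<close>. Gaining it twice makes the iterated integral a contraction.\<close>

lemma abs_integral_le_exp:
  fixes g :: "real \<Rightarrow> real"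
  assumes "0 < K" "0 \<le> r" "continuous_on {0..r} g"
    and le: "\<And>s. s \<in> {0..r} \<Longrightarrow> \<bar>g s\<bar> \<le> C * exp (K * s)"
  shows "\<bar>integral {0..r} g\<bar> \<le> C / K * exp (K * r)"
proof -
  have "((\<lambda>s. C * exp (K * s)) has_integral (C / K * exp (K * r) - C / K * exp (K * 0))) {0..r}"
    using assms(1,2)
    by (intro fundamental_theorem_of_calculus)
       (auto intro!: derivative_eq_intros simp flip: has_real_derivative_iff_has_vector_derivative)
  then have *: "(\<lambda>s. C * exp (K * s)) integrable_on {0..r}"
      "integral {0..r} (\<lambda>s. C * exp (K * s)) = C / K * exp (K * r) - C / K"
    by (auto intro: integral_unique simp: integrable_on_def simp del: integral_mult_right)
  \<comment> \<open>The bound at 0 forces \<open>C\<close> to be nonnegative, so the subtracted term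
    \<open>C / K\<close> may be dropped.\<close>
  have "\<bar>g 0\<bar> \<le> C * exp (K * 0)"
    using le[of 0] assms(2) by simp
  then have "0 \<le> C" by simp
  have "norm (integral {0..r} g) \<le> integral {0..r} (\<lambda>s. C * exp (K * s))"
    using le *(1) assms(3) by (intro integral_norm_bound_integral) (auto intro: integrable_continuous_real)
  with * \<open>0 \<le> C\<close> \<open>0 < K\<close> show ?thesis
    by (smt (verit) divide_nonneg_pos real_norm_def)
qed

text \<open>\<open>bcontfun\<close> consists of functions on the whole line. Freezing the argument
  at the ends of \<open>{0..T}\<close> extends \<open>h\<close> to such a function without changing
  it inside.\<close>

lemma clamp_continuous_in_bcontfun:
  fixes h :: "real \<Rightarrow> real"
  assumes "0 \<le> T" "continuous_on {0..T} h"
  shows "(\<lambda>t. h (max 0 (min T t))) \<in> bcontfun"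
proof -
  have *: "continuous_on UNIV (\<lambda>t. h (max 0 (min T t)))"
    using assms by (intro continuous_on_compose2[OF assms(2)] continuous_intros) auto
  have "bounded (h ` {0..T})"
    using assms by (intro compact_imp_bounded compact_continuous_image) auto
  then obtain B where "\<And>t. t \<in> {0..T} \<Longrightarrow> norm (h t) \<le> B"
    unfolding bounded_iff by blast
  with * assms(1) show ?thesis
    by (intro bcontfun_normI[of _ B]) auto
qed

text \<open>The fixed point is taken for \<open>z t = exp (- K t) * w t\<close>: with this weight and \<open>K\<close> large, the
  integral operator is a contraction on all of \<open>{0..T}\<close>.\<close>

lemma second_order_ivp_exists:
  fixes q f :: "real \<Rightarrow> real"
  assumes "0 < T" "continuous_on {0..T} q"
    and lip: "\<And>x y. \<bar>f x - f y\<bar> \<le> L * \<bar>x - y\<bar>"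
  obtains w w' where "w 0 = a" "w' 0 = 0"
    "\<And>t. t \<in> {0..T} \<Longrightarrow> (w has_real_derivative w' t) (at t within {0..T})"
    "\<And>t. t \<in> {0..T} \<Longrightarrow> (w' has_real_derivative - q t * f (w t)) (at t within {0..T})"
proof -
  have "0 \<le> L" using lip[of 1 0] by simp
  have "bounded (q ` {0..T})"
    using assms by (intro compact_imp_bounded compact_continuous_image) auto
  then obtain Q where "0 < Q" and Q: "\<And>t. t \<in> {0..T} \<Longrightarrow> \<bar>q t\<bar> \<le> Q"
    by (auto simp: bounded_pos)
  \<comment> \<open>From \<open>1 \<le> K\<close> and \<open>2 * Q * L \<le> K\<close> follows
    \<open>2 * Q * L \<le> K * K\<close>, so two integrations multiply distances by at most
    1/2.\<close>
  define K where "K = 1 + 2 * Q * L"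
  have "1 \<le> K" using \<open>0 < Q\<close> \<open>0 \<le> L\<close> by (simp add: K_def)
  have contf: "continuous_on S f" for S
    using lip \<open>0 \<le> L\<close>
    by (intro lipschitz_on_continuous_on[of L] lipschitz_onI) (auto simp: dist_real_def)
  \<comment> \<open>\<open>W\<close> removes the exponential weight, \<open>- G\<close> is the
    candidate for \<open>w'\<close>, and \<open>H\<close> is the weighted Picard operator. Clamping
    the time in \<open>\<Phi>\<close> makes it a self-map of \<open>bcontfun\<close>.\<close>
  define W where "W z s = exp (K * s) * apply_bcontfun z s" for z and s :: real
  define G where "G z r = integral {0..r} (\<lambda>s. q s * f (W z s))" for z and r :: real
  define H where "H z r = exp (- K * r) * (a - integral {0..r} (G z))" for z and r :: real
  define \<Phi> where "\<Phi> z = Bcontfun (\<lambda>t. H z (max 0 (min T t)))" for z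
  have contI: "continuous_on {0..T} (\<lambda>s. q s * f (W z s))" for z
    unfolding W_def
    by (intro continuous_intros assms continuous_on_compose2[OF contf[of UNIV]] continuous_on_apply_bcontfun) auto
  have derG: "(G z has_real_derivative q t * f (W z t)) (at t within {0..T})" if "t \<in> {0..T}" for z t
    unfolding G_def using integral_has_real_derivative[OF contI that] .
  have contG: "continuous_on {0..T} (G z)" for z
    by (rule DERIV_continuous_on[OF derG])
  have derI: "((\<lambda>r. integral {0..r} (G z)) has_real_derivative G z t) (at t within {0..T})"
    if "t \<in> {0..T}" for z t
    using integral_has_real_derivative[OF contG that] .
  have "continuous_on {0..T} (\<lambda>r. integral {0..r} (G z))" for z
    by (rule DERIV_continuous_on[OF derI])
  then have contH: "continuous_on {0..T} (H z)" for z
    unfolding H_def by (intro continuous_intros)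
  have \<Phi>: "apply_bcontfun (\<Phi> z) t = H z (max 0 (min T t))" for z t
    unfolding \<Phi>_def using \<open>0 < T\<close> contH
    by (subst Bcontfun_inverse) (auto intro!: clamp_continuous_in_bcontfun)
  have "dist (\<Phi> z) (\<Phi> y) \<le> 1 / 2 * dist z y" for z y
  proof (rule dist_bound)
    fix t
    define r where "r = max 0 (min T t)"
    have r: "r \<in> {0..T}" using \<open>0 < T\<close> by (auto simp: r_def)
    define d where "d = dist z y"
    have 1: "\<bar>q s * f (W z s) - q s * f (W y s)\<bar> \<le> Q * L * d * exp (K * s)" if "s \<in> {0..T}" for s
    proof -
      have "\<bar>W z s - W y s\<bar> = exp (K * s) * dist (apply_bcontfun z s) (apply_bcontfun y s)"
        by (simp add: W_def dist_real_def abs_mult flip: right_diff_distrib)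
      also have "\<dots> \<le> exp (K * s) * d"
        unfolding d_def by (intro mult_left_mono dist_bounded) auto
      finally have "L * \<bar>W z s - W y s\<bar> \<le> L * (exp (K * s) * d)"
        using \<open>0 \<le> L\<close> by (intro mult_left_mono)
      with lip[of "W z s" "W y s"] have "\<bar>f (W z s) - f (W y s)\<bar> \<le> L * (exp (K * s) * d)"
        by linarith
      with Q[OF that] have "\<bar>q s\<bar> * \<bar>f (W z s) - f (W y s)\<bar> \<le> Q * (L * (exp (K * s) * d))"
        using \<open>0 < Q\<close> by (intro mult_mono) auto
      then show ?thesis
        by (simp add: abs_mult ac_simps flip: right_diff_distrib)
    qed
    have 2: "\<bar>G z s - G y s\<bar> \<le> Q * L * d / K * exp (K * s)" if "s \<in> {0..T}" for s
    proof -
      have c: "continuous_on {0..s} (\<lambda>t. q t * f (W z t))" for z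
        using that by (intro continuous_on_subset[OF contI]) auto
      have "G z s - G y s = integral {0..s} (\<lambda>t. q t * f (W z t) - q t * f (W y t))"
        unfolding G_def by (intro integral_diff[symmetric] integrable_continuous_real c)
      also have "\<bar>\<dots>\<bar> \<le> Q * L * d / K * exp (K * s)"
        using that \<open>1 \<le> K\<close> 1
        by (intro abs_integral_le_exp continuous_on_diff c) auto
      finally show ?thesis .
    qed
    have c: "continuous_on {0..r} (G z)" for z
      using r by (intro continuous_on_subset[OF contG]) auto
    have "integral {0..r} (G z) - integral {0..r} (G y) = integral {0..r} (\<lambda>t. G z t - G y t)"
      by (intro integral_diff[symmetric] integrable_continuous_real c)
    also have "\<bar>\<dots>\<bar> \<le> (Q * L * d / K) / K * exp (K * r)"
      using r \<open>1 \<le> K\<close> 2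
      by (intro abs_integral_le_exp continuous_on_diff c) auto
    finally have 3: "\<bar>integral {0..r} (G z) - integral {0..r} (G y)\<bar> \<le> (Q * L * d / K) / K * exp (K * r)" .
    have "dist (H z r) (H y r) = exp (- K * r) * \<bar>integral {0..r} (G z) - integral {0..r} (G y)\<bar>"
      by (simp add: H_def dist_real_def abs_minus_commute abs_mult flip: right_diff_distrib)
    also have "\<dots> \<le> exp (- K * r) * ((Q * L * d / K) / K * exp (K * r))"
      by (intro mult_left_mono 3) auto
    also have "\<dots> = (Q * L / (K * K)) * d"
      by (simp add: exp_minus field_simps)
    also have "\<dots> \<le> 1 / 2 * d"
    proof (rule mult_right_mono)
      have "1 * K \<le> K * K" using \<open>1 \<le> K\<close> by (intro mult_right_mono) auto
      then have "2 * (Q * L) \<le> K * K" by (simp add: K_def)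
      then show "Q * L / (K * K) \<le> 1 / 2" using \<open>1 \<le> K\<close> by (simp add: divide_simps)
    qed (simp add: d_def)
    finally show "dist (apply_bcontfun (\<Phi> z) t) (apply_bcontfun (\<Phi> y) t) \<le> 1 / 2 * dist z y"
      by (simp add: \<Phi> r_def d_def)
  qed
  then have "\<exists>!z. \<Phi> z = z"
    by (intro banach_fix_type[of "1/2"]) auto
  then obtain z where z: "\<Phi> z = z" by blast
  \<comment> \<open>Without the weight, the fixed point equation is the integral equation;
    differentiating it twice gives the initial value problem.\<close>
  have W: "W z t = a - integral {0..t} (G z)" if "t \<in> {0..T}" for t
  proof -
    have "apply_bcontfun z t = H z t"
      using \<Phi>[of z t] that by (simp add: z)
    then show ?thesis by (simp add: W_def H_def exp_minus)
  qed
  show thesis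
  proof
    show "W z 0 = a" using W[of 0] \<open>0 < T\<close> by simp
    show "- G z 0 = 0" by (simp add: G_def)
    show "(W z has_real_derivative - G z t) (at t within {0..T})" if "t \<in> {0..T}" for t
    proof (rule has_field_derivative_transform_within[OF _ zero_less_one that])
      show "((\<lambda>t. a - integral {0..t} (G z)) has_real_derivative - G z t) (at t within {0..T})"
        using derI[OF that] by (auto intro!: derivative_eq_intros)
    qed (simp add: W)
    show "((\<lambda>t. - G z t) has_real_derivative - q t * f (W z t)) (at t within {0..T})"
      if "t \<in> {0..T}" for t
      using derG[OF that] by (auto intro!: derivative_eq_intros)
  qed
qed

text \<open>Energy estimate: the sum of the squares of \<open>D\<close> and \<open>D'\<close>,
  damped by \<open>exp (- K * t)\<close>, is nonincreasing and starts at 0.\<close>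

lemma second_order_zero_unique:
  fixes D D' D'' :: "real \<Rightarrow> real"
  assumes "continuous_on {0..b} D" "continuous_on {0..b} D'" "D 0 = 0" "D' 0 = 0"
    and der: "\<And>t. 0 < t \<Longrightarrow> t < b \<Longrightarrow> (D has_real_derivative D' t) (at t)"
      "\<And>t. 0 < t \<Longrightarrow> t < b \<Longrightarrow> (D' has_real_derivative D'' t) (at t)"
    and le: "\<And>t. 0 < t \<Longrightarrow> t < b \<Longrightarrow> \<bar>D'' t\<bar> \<le> C * \<bar>D t\<bar>"
    and "t \<in> {0..b}"
  shows "D t = 0"
proof -
  \<comment> \<open>The energy has derivative at most
    \<open>2 * (1 + \<bar>C\<bar>) * \<bar>D\<bar> * \<bar>D'\<bar>\<close>, which is at most
    \<open>K\<close> times the energy itself.\<close>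
  define K where "K = 1 + \<bar>C\<bar>"
  let ?F = "\<lambda>t. ((D t)\<^sup>2 + (D' t)\<^sup>2) * exp (- K * t)"
  have "?F t \<le> ?F 0"
  proof (rule DERIV_nonpos_imp_decreasing_open[where f = ?F])
    show "continuous_on {0..t} ?F"
      using assms(8) by (intro continuous_intros continuous_on_subset[OF assms(1)]
        continuous_on_subset[OF assms(2)]) auto
    fix s assume s: "0 < s" "s < t"
    then have "s < b" using assms(8) by auto
    have "2 * (\<bar>D s\<bar> * \<bar>D' s\<bar>) \<le> (D s)\<^sup>2 + (D' s)\<^sup>2"
      using sum_squares_bound[of "\<bar>D s\<bar>" "\<bar>D' s\<bar>"] by simp
    then have 2: "K * (2 * (\<bar>D s\<bar> * \<bar>D' s\<bar>)) \<le> K * ((D s)\<^sup>2 + (D' s)\<^sup>2)"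
      by (intro mult_left_mono) (auto simp: K_def)
    have "\<bar>D'' s\<bar> \<le> \<bar>C\<bar> * \<bar>D s\<bar>"
      using le[OF s(1) \<open>s < b\<close>] by (smt (verit) mult_right_mono abs_ge_zero abs_ge_self)
    then have "\<bar>D' s\<bar> * \<bar>D'' s\<bar> \<le> \<bar>D' s\<bar> * (\<bar>C\<bar> * \<bar>D s\<bar>)"
      by (intro mult_left_mono) auto
    moreover have "D' s * D'' s \<le> \<bar>D' s\<bar> * \<bar>D'' s\<bar>" "D s * D' s \<le> \<bar>D s\<bar> * \<bar>D' s\<bar>"
      by (metis abs_ge_self abs_mult)+
    ultimately have "2 * D s * D' s + 2 * D' s * D'' s \<le> K * (2 * (\<bar>D s\<bar> * \<bar>D' s\<bar>))"
      by (simp add: K_def algebra_simps)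
    with 2 have "(2 * D s * D' s + 2 * D' s * D'' s - K * ((D s)\<^sup>2 + (D' s)\<^sup>2)) * exp (- K * s) \<le> 0"
      by (intro mult_nonpos_nonneg) auto
    moreover have "(?F has_real_derivative
        (2 * D s * D' s + 2 * D' s * D'' s - K * ((D s)\<^sup>2 + (D' s)\<^sup>2)) * exp (- K * s)) (at s)"
      using der(1)[OF s(1) \<open>s < b\<close>] der(2)[OF s(1) \<open>s < b\<close>]
      by (auto intro!: derivative_eq_intros simp: algebra_simps power2_eq_square)
    ultimately show "\<exists>y. (?F has_real_derivative y) (at s) \<and> y \<le> 0" by blast
  qed (use assms in auto)
  with assms(3,4) have "(D t)\<^sup>2 + (D' t)\<^sup>2 \<le> 0"
    by (simp add: mult_le_0_iff)
  then show ?thesis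
    by (smt (verit) zero_le_power2 power2_eq_iff zero_eq_power2)
qed

section \<open>The profile and its first zero\<close>

text \<open>Subtracting the line of slope \<open>c\<close> leaves a nonincreasing function. The
  outer interval \<open>{a..b}\<close> stays fixed so that derivatives from an initial value problem
  can be used on subintervals.\<close>

lemma diff_le_of_deriv_le:
  fixes g g' :: "real \<Rightarrow> real"
  assumes der: "\<And>x. x \<in> {a..b} \<Longrightarrow> (g has_real_derivative g' x) (at x within {a..b})"
    and "a \<le> s" "s \<le> t" "t \<le> b" and le: "\<And>x. s < x \<Longrightarrow> x < t \<Longrightarrow> g' x \<le> c"
  shows "g t - g s \<le> c * (t - s)"
proof -
  have "g t - c * t \<le> g s - c * s"
  proof (rule DERIV_nonpos_imp_decreasing_open[where f = "\<lambda>x. g x - c * x"])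
    show "continuous_on {s..t} (\<lambda>x. g x - c * x)"
      using assms(2-4)
      by (intro continuous_intros continuous_on_subset[OF DERIV_continuous_on[OF der]]) auto
    fix x assume x: "s < x" "x < t"
    then have "(g has_real_derivative g' x) (at x)"
      using der[of x] assms(2-4) by (simp add: at_within_Icc_at)
    then have "((\<lambda>x. g x - c * x) has_real_derivative g' x - c) (at x)"
      by (auto intro!: derivative_eq_intros)
    with le[OF x] show "\<exists>y. ((\<lambda>x. g x - c * x) has_real_derivative y) (at x) \<and> y \<le> 0"
      by auto
  qed (rule assms)
  then show ?thesis by (simp add: algebra_simps)
qed

lemma deriv_neg_imp_less:
  fixes g g' :: "real \<Rightarrow> real"
  assumes der: "\<And>x. x \<in> {a..b} \<Longrightarrow> (g has_real_derivative g' x) (at x within {a..b})"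
    and "a \<le> s" "s < t" "t \<le> b" and neg: "\<And>x. s < x \<Longrightarrow> x < t \<Longrightarrow> g' x < 0"
  shows "g t < g s"
proof (rule DERIV_neg_imp_decreasing_open[where f = g])
  show "continuous_on {s..t} g"
    using assms(2-4) by (intro continuous_on_subset[OF DERIV_continuous_on[OF der]]) auto
  fix x assume x: "s < x" "x < t"
  then have "(g has_real_derivative g' x) (at x)"
    using der[of x] assms(2-4) by (simp add: at_within_Icc_at)
  with neg[OF x] show "\<exists>y. (g has_real_derivative y) (at x) \<and> y < 0" by blast
qed (rule assms)

text \<open>Each branch takes a value between the end values and the peak exactly once: at least
  once by the intermediate value theorem, at most once by strict monotonicity. Strict inequality at
  the ends puts both points in the open interval.\<close>

lemma unimodal_level_sets:
  fixes F :: "real \<Rightarrow> real"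
  assumes cont: "continuous_on {a..b} F" and "a < m" "m < b" "F a < c" "F b < c"
    and inc: "strict_mono_on {a..m} F" and dec: "strict_antimono_on {m..b} F"
  shows "c < F m \<Longrightarrow> card {r \<in> {a<..<b}. F r = c} = 2"
    and "c = F m \<Longrightarrow> {r \<in> {a<..<b}. F r = c} = {m}"
    and "F m < c \<Longrightarrow> {r \<in> {a<..<b}. F r = c} = {}"
proof -
  have less: "F s < F t" if "a \<le> s" "s < t" "t \<le> m" for s t
    using strict_mono_onD[OF inc] that by auto
  have gt: "F t < F s" if "m \<le> s" "s < t" "t \<le> b" for s t
    using monotone_onD[OF dec] that by auto
  have max: "F r < F m" if "a \<le> r" "r \<le> b" "r \<noteq> m" for r
    using less[of r m] gt[of m r] that by (cases "r < m") auto
  have le: "F r \<le> F m" and eq: "F r = F m \<Longrightarrow> r = m" if "a < r" "r < b" for r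
    using max[of r] that by force+
  show "c = F m \<Longrightarrow> {r \<in> {a<..<b}. F r = c} = {m}"
    using eq assms(2,3) by auto
  show "F m < c \<Longrightarrow> {r \<in> {a<..<b}. F r = c} = {}"
    using le by (auto simp: not_less[symmetric])
  assume "c < F m"
  have "\<exists>r\<ge>a. r \<le> m \<and> F r = c"
    using assms \<open>c < F m\<close> by (intro IVT') (auto intro: continuous_on_subset[OF cont])
  then obtain r1 where r1: "a \<le> r1" "r1 \<le> m" "F r1 = c" by blast
  have "\<exists>r\<ge>m. r \<le> b \<and> F r = c"
    using assms \<open>c < F m\<close> by (intro IVT2') (auto intro: continuous_on_subset[OF cont])
  then obtain r2 where r2: "m \<le> r2" "r2 \<le> b" "F r2 = c" by blast
  have "a < r1" "r1 < m" "m < r2" "r2 < b"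
    using r1 r2 assms(4,5) \<open>c < F m\<close> by (auto simp: order.strict_iff_order)
  moreover have "r = r1 \<or> r = r2" if "a < r" "r < b" "F r = c" for r
  proof (cases "r \<le> m")
    case True
    then show ?thesis
      using less[of r r1] less[of r1 r] that r1 by (cases r r1 rule: linorder_cases) auto
  next
    case False
    then show ?thesis
      using gt[of r r2] gt[of r2 r] that r2 by (cases r r2 rule: linorder_cases) auto
  qed
  ultimately have "{r \<in> {a<..<b}. F r = c} = {r1, r2}"
    using r1(3) r2(3) by auto
  with \<open>r1 < m\<close> \<open>m < r2\<close> show "card {r \<in> {a<..<b}. F r = c} = 2"
    by simp
qed

text \<open>\<open>R\<close> is the first zero of the profile. Derivatives within
  \<open>{0..R}\<close> are one-sided at both ends, as an initial value problem on an interval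
  provides them.\<close>

locale emden_profile =
  fixes l p R :: real and w w' :: "real \<Rightarrow> real"
  assumes l_pos: "0 < l" and p_gt_1: "1 < p" and R_pos: "0 < R"
    and w_0: "w 0 = 1" and w_R: "w R = 0" and w'_0: "w' 0 = 0"
    and w_pos: "\<And>r. 0 \<le> r \<Longrightarrow> r < R \<Longrightarrow> 0 < w r"
    and w_deriv: "\<And>r. r \<in> {0..R} \<Longrightarrow> (w has_real_derivative w' r) (at r within {0..R})"
    and w'_deriv: "\<And>r. r \<in> {0..R} \<Longrightarrow>
      (w' has_real_derivative - (r powr l * w r powr p)) (at r within {0..R})"

text \<open>A truncated problem is solved on a long interval and stopped at the first zero. A zero
  occurs because \<open>w'\<close> is nonincreasing and strictly negative from 1/2 on, so
  \<open>w\<close> falls at least linearly.\<close>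

lemma emden_profile_exists:
  fixes l p :: real
  assumes "0 < l" "1 < p"
  shows "\<exists>R w w'. emden_profile l p R w w'"
proof -
  \<comment> \<open>The truncation makes the power globally Lipschitz. It changes nothing as long as
    \<open>0 \<le> w\<close>, since \<open>w \<le> 1\<close> holds automatically.\<close>
  define f :: "real \<Rightarrow> real" where "f y = max 0 (min 1 y) powr p" for y
  have f01: "0 \<le> f y" "f y \<le> 1" for y
    unfolding f_def using assms by (auto intro!: powr_le1)
  have lip: "\<bar>f x - f y\<bar> \<le> p * \<bar>x - y\<bar>" for x y
  proof -
    have "\<bar>f x - f y\<bar> \<le> p * 1 powr (p - 1) * \<bar>max 0 (min 1 x) - max 0 (min 1 y)\<bar>"
      unfolding f_def using assms by (intro powr_lipschitz_on_Icc) auto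
    also have "\<dots> \<le> p * \<bar>x - y\<bar>"
      using assms by (auto intro!: mult_left_mono)
    finally show ?thesis .
  qed
  \<comment> \<open>The decrease of \<open>w'\<close> on \<open>{1/4..1/2}\<close> is at least \<open>m / 4\<close>, so \<open>w\<close> has a zero in \<open>{0..T}\<close>.\<close>
  define m :: real where "m = (1/4) powr l * (1/2) powr p"
  have m: "0 < m" "m \<le> 1"
    unfolding m_def using assms by (auto intro!: mult_le_one powr_le1)
  \<comment> \<open>Over the length \<open>4 / m\<close>, a slope of at most \<open>- m / 4\<close>
    lowers \<open>w\<close> by at least 1, from at most 1 to at most 0.\<close>
  define T where "T = 1/2 + 4 / m"
  have "1 \<le> T" using m by (simp add: T_def field_simps)
  have contq: "continuous_on {0..T} (\<lambda>r. r powr l)"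
    using assms by (intro continuous_on_powr') (auto intro!: continuous_intros)
  obtain w w' where w0: "w 0 = 1" and w'0: "w' 0 = 0"
    and dw: "\<And>t. t \<in> {0..T} \<Longrightarrow> (w has_real_derivative w' t) (at t within {0..T})"
    and dw': "\<And>t. t \<in> {0..T} \<Longrightarrow>
      (w' has_real_derivative - (t powr l) * f (w t)) (at t within {0..T})"
    by (rule second_order_ivp_exists[OF _ contq lip, where a = 1]) (use \<open>1 \<le> T\<close> in auto)
  \<comment> \<open>The truncated \<open>f\<close> is nonnegative everywhere, so concavity persists
    past a zero of \<open>w\<close>.\<close>
  have mono': "w' t \<le> w' s" if "0 \<le> s" "s \<le> t" "t \<le> T" for s t
    using diff_le_of_deriv_le[OF dw' that, of 0] f01 by simp
  have w'_le: "w' t \<le> 0" if "0 \<le> t" "t \<le> T" for t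
    using mono'[of 0 t] that w'0 by simp
  have w_le: "w t \<le> 1" if "0 \<le> t" "t \<le> T" for t
    using diff_le_of_deriv_le[OF dw order.refl that, of 0] w'_le that w0 by simp
  \<comment> \<open>On \<open>{0..1}\<close> both the weight and \<open>f\<close> are at most 1, so
    \<open>w'\<close> is at least -1; this keeps \<open>w\<close> above 1/2 up to time 1/2.\<close>
  have w'_ge: "- 1 \<le> w' t" if "0 \<le> t" "t \<le> 1" for t
  proof -
    have "(- w' t) - (- w' 0) \<le> 1 * (t - 0)"
    proof (rule diff_le_of_deriv_le[where g = "\<lambda>t. - w' t"])
      show "((\<lambda>t. - w' t) has_real_derivative x powr l * f (w x)) (at x within {0..T})"
        if "x \<in> {0..T}" for x
        using dw'[OF that] by (auto intro!: derivative_eq_intros)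
      show "x powr l * f (w x) \<le> 1" if "0 < x" "x < t" for x
        using that \<open>t \<le> 1\<close> f01 assms by (intro mult_le_one powr_le1) auto
    qed (use that \<open>1 \<le> T\<close> in auto)
    with that w'0 show ?thesis by simp
  qed
  have w_ge: "1 / 2 \<le> w t" if "0 \<le> t" "t \<le> 1 / 2" for t
  proof -
    have "(- w t) - (- w 0) \<le> 1 * (t - 0)"
    proof (rule diff_le_of_deriv_le[where g = "\<lambda>t. - w t"])
      show "((\<lambda>t. - w t) has_real_derivative - w' x) (at x within {0..T})"
        if "x \<in> {0..T}" for x
        using dw[OF that] by (auto intro!: derivative_eq_intros)
      show "- w' x \<le> 1" if "0 < x" "x < t" for x
        using w'_ge[of x] that \<open>t \<le> 1 / 2\<close> by simp
    qed (use that \<open>1 \<le> T\<close> in auto)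
    with that w0 show ?thesis by simp
  qed
  have "w' (1/2) - w' (1/4) \<le> - m * (1/2 - 1/4)"
  proof (rule diff_le_of_deriv_le[OF dw'])
    fix x :: real assume x: "1/4 < x" "x < 1/2"
    have "(1/4) powr l \<le> x powr l" using x assms by (intro powr_mono2) auto
    moreover have "(1/2) powr p \<le> f (w x)"
      unfolding f_def using w_ge[of x] x assms by (intro powr_mono2) auto
    ultimately show "- (x powr l) * f (w x) \<le> - m"
      unfolding m_def by (auto intro!: mult_mono)
  qed (use \<open>1 \<le> T\<close> in auto)
  then have half: "w' (1/2) \<le> - m / 4"
    using w'_le[of "1/4"] \<open>1 \<le> T\<close> by simp
  have "w T - w (1/2) \<le> - m / 4 * (T - 1/2)"
  proof (rule diff_le_of_deriv_le[OF dw])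
    show "w' x \<le> - m / 4" if "1/2 < x" "x < T" for x
      using mono'[of "1/2" x] half that by simp
  qed (use \<open>1 \<le> T\<close> in auto)
  moreover have "- m / 4 * (T - 1/2) = - 1" using m by (simp add: T_def)
  ultimately have "w T \<le> 0" using w_le[of "1/2"] \<open>1 \<le> T\<close> by simp
  have contw: "continuous_on {0..T} w" by (rule DERIV_continuous_on[OF dw])
  define Z where "Z = {t \<in> {0..T}. w t = 0}"
  have "\<exists>t\<ge>0. t \<le> T \<and> w t = 0"
    using \<open>w T \<le> 0\<close> \<open>1 \<le> T\<close> w0 by (intro IVT2' contw) auto
  then have "Z \<noteq> {}" by (auto simp: Z_def)
  moreover have "compact Z"
    unfolding compact_eq_bounded_closed
  proof
    show "bounded Z" by (rule bounded_subset[OF bounded_closed_interval[of 0 T]]) (auto simp: Z_def)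
    show "closed Z" unfolding Z_def by (intro continuous_closed_preimage_constant contw closed_real_atLeastAtMost)
  qed
  ultimately obtain R where "R \<in> Z" and least: "\<And>t. t \<in> Z \<Longrightarrow> R \<le> t"
    using compact_attains_inf by metis
  have "0 \<le> R" "R \<le> T" "w R = 0" "R \<noteq> 0"
    using \<open>R \<in> Z\<close> w0 by (auto simp: Z_def)
  then have R: "0 < R" "R \<le> T" "w R = 0" by simp_all
  have pos: "0 < w r" if "0 \<le> r" "r < R" for r
  proof (rule ccontr)
    assume "\<not> 0 < w r"
    then have "\<exists>t\<ge>0. t \<le> r \<and> w t = 0"
      using that w0 R by (intro IVT2' continuous_on_subset[OF contw]) auto
    then obtain t where "0 \<le> t" "t \<le> r" "w t = 0" by blast
    with least[of t] that R show False by (simp add: Z_def)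
  qed
  have sub: "{0..R} \<subseteq> {0..T}" using R by auto
  \<comment> \<open>Up to \<open>R\<close> the values of \<open>w\<close> lie in
    \<open>{0..1}\<close>, where \<open>f\<close> is the plain power, so the original equation holds
    there.\<close>
  have fw: "f (w r) = w r powr p" if "r \<in> {0..R}" for r
    using pos[of r] w_le[of r] R that unfolding f_def
    by (cases "r = R") (auto simp: min_def max_def)
  have "emden_profile l p R w w'"
  proof
    show "(w has_real_derivative w' r) (at r within {0..R})" if "r \<in> {0..R}" for r
      using dw[of r] that sub by (blast intro: DERIV_subset)
    show "(w' has_real_derivative - (r powr l * w r powr p)) (at r within {0..R})"
      if "r \<in> {0..R}" for r
      using DERIV_subset[OF dw'[of r] sub] that sub by (simp add: fw subset_iff)
  qed (use assms R w0 w'0 pos in auto)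
  then show ?thesis by blast
qed

section \<open>Positive even solutions as rescaled profiles\<close>

text \<open>Only 0 needs an argument: the one-sided difference quotients there share a limit, and
  the two half intervals together form a neighbourhood.\<close>

lemma has_real_derivative_glue_at_0:
  fixes G G' :: "real \<Rightarrow> real"
  assumes right: "\<And>x. x \<in> {0..R} \<Longrightarrow> (G has_real_derivative G' x) (at x within {0..R})"
    and left: "\<And>x. x \<in> {-R..0} \<Longrightarrow> (G has_real_derivative G' x) (at x within {-R..0})"
    and "\<bar>x\<bar> < R"
  shows "(G has_real_derivative G' x) (at x)"
proof (cases x "0 :: real" rule: linorder_cases)
  case less
  with left[of x] assms(3) show ?thesis by (simp add: at_within_Icc_at)
next
  case equal
  have "(G has_real_derivative G' 0) (at 0 within {-R..0} \<union> {0..R})"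
    using right[of 0] left[of 0] assms(3)
    by (simp add: has_field_derivative_iff Lim_within_Un)
  moreover have "{-R..0} \<union> {0..R} = {-R..R}" using assms(3) by auto
  ultimately show ?thesis using equal assms(3) by (simp add: at_within_Icc_at)
next
  case greater
  with right[of x] assms(3) show ?thesis by (simp add: at_within_Icc_at)
qed

lemma has_real_derivative_mirror_Icc:
  fixes g :: "real \<Rightarrow> real"
  assumes "(g has_real_derivative D) (at (- x) within {0..R})"
  shows "((\<lambda>x. g (- x)) has_real_derivative - D) (at x within {-R..0})"
  using DERIV_image_chain[of g D uminus x "{-R..0}" "-1"] assms
  by (simp add: o_def DERIV_minus[OF DERIV_ident])

text \<open>The one-sided slopes at 0 are \<open>g' 0\<close> and \<open>- g' 0\<close>; they agree
  because both vanish, matching \<open>sgn 0 = 0\<close>.\<close>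

lemma even_extension_deriv:
  fixes g g' :: "real \<Rightarrow> real"
  assumes der: "\<And>r. r \<in> {0..R} \<Longrightarrow> (g has_real_derivative g' r) (at r within {0..R})"
    and "g' 0 = 0" "\<bar>x\<bar> < R"
  shows "((\<lambda>x. g \<bar>x\<bar>) has_real_derivative sgn x * g' \<bar>x\<bar>) (at x)"
proof (rule has_real_derivative_glue_at_0[OF _ _ assms(3)])
  fix x :: real assume x: "x \<in> {0..R}"
  with der[OF x] assms(2) have "(g has_real_derivative sgn x * g' \<bar>x\<bar>) (at x within {0..R})"
    by (cases "x = 0") auto
  then show "((\<lambda>x. g \<bar>x\<bar>) has_real_derivative sgn x * g' \<bar>x\<bar>) (at x within {0..R})"
    by (rule has_field_derivative_transform_within[OF _ zero_less_one x]) simp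
next
  fix x :: real assume x: "x \<in> {-R..0}"
  then have "((\<lambda>x. g (- x)) has_real_derivative - g' (- x)) (at x within {-R..0})"
    by (intro has_real_derivative_mirror_Icc der) auto
  with x assms(2) have "((\<lambda>x. g (- x)) has_real_derivative sgn x * g' \<bar>x\<bar>) (at x within {-R..0})"
    by (cases "x = 0") auto
  then show "((\<lambda>x. g \<bar>x\<bar>) has_real_derivative sgn x * g' \<bar>x\<bar>) (at x within {-R..0})"
    by (rule has_field_derivative_transform_within[OF _ zero_less_one x]) simp
qed

text \<open>Reflecting both argument and value preserves the slope, and \<open>g 0 = 0\<close> makes
  the extension agree with both branches at 0.\<close>

lemma odd_extension_deriv:
  fixes g g' :: "real \<Rightarrow> real"
  assumes der: "\<And>r. r \<in> {0..R} \<Longrightarrow> (g has_real_derivative g' r) (at r within {0..R})"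
    and "g 0 = 0" "\<bar>x\<bar> < R"
  shows "((\<lambda>x. sgn x * g \<bar>x\<bar>) has_real_derivative g' \<bar>x\<bar>) (at x)"
proof (rule has_real_derivative_glue_at_0[OF _ _ assms(3)])
  fix x :: real assume x: "x \<in> {0..R}"
  with der[OF x] have "(g has_real_derivative g' \<bar>x\<bar>) (at x within {0..R})"
    by simp
  then show "((\<lambda>x. sgn x * g \<bar>x\<bar>) has_real_derivative g' \<bar>x\<bar>) (at x within {0..R})"
    by (rule has_field_derivative_transform_within[OF _ zero_less_one x])
       (use assms(2) in \<open>auto simp: sgn_if\<close>)
next
  fix x :: real assume x: "x \<in> {-R..0}"
  then have "((\<lambda>x. - g (- x)) has_real_derivative - (- g' (- x))) (at x within {-R..0})"
    by (intro DERIV_minus has_real_derivative_mirror_Icc der) auto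
  with x have "((\<lambda>x. - g (- x)) has_real_derivative g' \<bar>x\<bar>) (at x within {-R..0})"
    by simp
  then show "((\<lambda>x. sgn x * g \<bar>x\<bar>) has_real_derivative g' \<bar>x\<bar>) (at x within {-R..0})"
    by (rule has_field_derivative_transform_within[OF _ zero_less_one x])
       (use assms(2) in \<open>auto simp: sgn_if\<close>)
qed

section \<open>Monotonicity of the profile and shape of the parameter curve\<close>

context emden_profile
begin

text \<open>\<open>w'\<close> starts at 0 with a negative derivative. Only its sign inside the
  interval is used, so the endpoint \<open>R\<close>, where \<open>w''\<close> vanishes, is
  included.\<close>

lemma w'_neg: "w' r < 0" if "0 < r" "r \<le> R"
proof -
  have "- (x powr l * w x powr p) < 0" if "0 < x" "x < r" for x
    using w_pos[of x] that \<open>r \<le> R\<close> by simp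
  then show ?thesis
    using deriv_neg_imp_less[OF w'_deriv order.refl that] w'_0 by simp
qed

lemma w_less: "w t < w s" if "0 \<le> s" "s < t" "t \<le> R"
  using deriv_neg_imp_less[OF w_deriv that] w'_neg that by simp

lemma w_le_1: "w t \<le> 1" if "0 \<le> t" "t \<le> R"
  using w_less[of 0 t] w_0 that by (cases "t = 0") auto

lemma w_nonneg: "0 \<le> w t" if "0 \<le> t" "t \<le> R"
  using w_pos[of t] w_R that by (cases "t = R") auto

lemma w_cont: "continuous_on {0..R} w"
  by (rule DERIV_continuous_on[OF w_deriv])

text \<open>In the equation for the rescaled profile, two derivatives contribute
  \<open>b * b\<close>, the weight contributes \<open>b powr l\<close>, and division by
  \<open>w b\<close> contributes \<open>w b powr (p - 1)\<close>.\<close>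

definition param :: "real \<Rightarrow> real" where
  "param b = b powr (l + 2) * w b powr (p - 1)"

lemma param_cont: "continuous_on {0..R} param"
  unfolding param_def using l_pos p_gt_1 w_nonneg
  by (intro continuous_intros continuous_on_powr' w_cont) auto

text \<open>This is the product rule with a factor pulled out that is positive inside the interval,
  so the bracket carries the sign.\<close>

lemma param_deriv:
  assumes "0 < r" "r < R"
  shows "(param has_real_derivative
    r powr (l + 1) * w r powr (p - 2) * ((l + 2) * w r + (p - 1) * (r * w' r))) (at r)"
proof -
  have "(w has_real_derivative w' r) (at r)"
    using w_deriv[of r] assms by (simp add: at_within_Icc_at)
  moreover have "((\<lambda>z. z powr (p - 1)) has_real_derivative (p - 1) * w r powr (p - 2)) (at (w r))"
    using has_real_derivative_powr[of "w r" "p - 1"] w_pos[of r] assms by simp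
  ultimately have "((\<lambda>r. w r powr (p - 1)) has_real_derivative (p - 1) * w r powr (p - 2) * w' r) (at r)"
    by (rule DERIV_chain2[rotated])
  moreover have "((\<lambda>r. r powr (l + 2)) has_real_derivative (l + 2) * r powr (l + 1)) (at r)"
    using has_real_derivative_powr[of r "l + 2"] assms by (simp add: algebra_simps)
  ultimately have "(param has_real_derivative (l + 2) * r powr (l + 1) * w r powr (p - 1)
      + (p - 1) * w r powr (p - 2) * w' r * r powr (l + 2)) (at r)"
    unfolding param_def by (rule DERIV_mult[rotated])
  moreover have "w r powr (p - 1) = w r powr (p - 2) * w r" "r powr (l + 2) = r powr (l + 1) * r"
    using powr_add[of "w r" "p - 2" 1] powr_add[of r "l + 1" 1] w_pos[of r] assms
    by (simp_all add: add.commute)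
  ultimately show ?thesis by (simp add: algebra_simps)
qed

lemma param_unimodal:
  obtains m where "0 < m" "m < R" "strict_mono_on {0..m} param" "strict_antimono_on {m..R} param"
proof -
  define \<phi> where "\<phi> r = (l + 2) * w r + (p - 1) * (r * w' r)" for r
  \<comment> \<open>\<open>w''\<close> is replaced through the equation; the coefficient
    \<open>l + p + 1\<close> adds \<open>l + 2\<close> to the \<open>p - 1\<close> from the product
    rule.\<close>
  define \<phi>' where "\<phi>' r = (l + p + 1) * w' r - (p - 1) * (r * (r powr l * w r powr p))" for r
  have d\<phi>: "(\<phi> has_real_derivative \<phi>' r) (at r within {0..R})" if "r \<in> {0..R}" for r
    unfolding \<phi>_def \<phi>'_def using w_deriv[OF that] w'_deriv[OF that]
    by (auto intro!: derivative_eq_intros simp: algebra_simps)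
  have "\<phi>' r < 0" if "0 < r" "r < R" for r
  proof -
    have "(l + p + 1) * w' r < 0"
      using w'_neg[of r] l_pos p_gt_1 that by (intro mult_pos_neg) auto
    moreover have "0 \<le> (p - 1) * (r * (r powr l * w r powr p))"
      using that p_gt_1 by simp
    ultimately show ?thesis by (simp add: \<phi>'_def)
  qed
  then have \<phi>_less: "\<phi> t < \<phi> s" if "0 \<le> s" "s < t" "t \<le> R" for s t
    using deriv_neg_imp_less[OF d\<phi> that] that by simp
  have "\<phi> 0 = l + 2" by (simp add: \<phi>_def w_0)
  have "\<phi> R < 0" using w'_neg[of R] R_pos p_gt_1 by (simp add: \<phi>_def w_R mult_pos_neg)
  have "\<exists>m\<ge>0. m \<le> R \<and> \<phi> m = 0"
    using \<open>\<phi> 0 = l + 2\<close> \<open>\<phi> R < 0\<close> l_pos R_pos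
    by (intro IVT2' DERIV_continuous_on[OF d\<phi>]) auto
  then obtain m where m: "0 \<le> m" "m \<le> R" "\<phi> m = 0" by blast
  with \<open>\<phi> 0 = l + 2\<close> \<open>\<phi> R < 0\<close> l_pos have "m \<noteq> 0" "m \<noteq> R" by auto
  with m have "0 < m" "m < R" by auto
  have der: "(param has_real_derivative r powr (l + 1) * w r powr (p - 2) * \<phi> r) (at r)"
    "0 < r powr (l + 1) * w r powr (p - 2)" if "0 < r" "r < R" for r
    using param_deriv[OF that] w_pos[of r] that by (auto simp: \<phi>_def)
  show thesis
  proof
    show "strict_mono_on {0..m} param"
    proof (rule strict_mono_onI)
      fix s t assume st: "s \<in> {0..m}" "t \<in> {0..m}" "s < t"
      show "param s < param t"
      proof (rule DERIV_pos_imp_increasing_open[where f = param])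
        show "continuous_on {s..t} param"
          using st m by (intro continuous_on_subset[OF param_cont]) auto
        fix r assume r: "s < r" "r < t"
        with st m \<phi>_less[of r m] have "0 < \<phi> r" by simp
        moreover have "0 < r" "r < R" using r st m by auto
        ultimately show "\<exists>y. (param has_real_derivative y) (at r) \<and> 0 < y"
          using der[of r] mult_pos_pos by blast
      qed (rule st)
    qed
    show "strict_antimono_on {m..R} param"
    proof (rule monotone_onI)
      fix s t assume st: "s \<in> {m..R}" "t \<in> {m..R}" "s < t"
      show "param s > param t"
      proof (rule DERIV_neg_imp_decreasing_open[where f = param])
        show "continuous_on {s..t} param"
          using st m by (intro continuous_on_subset[OF param_cont]) auto
        fix r assume r: "s < r" "r < t"
        with st m \<phi>_less[of m r] have "\<phi> r < 0" by simp
        moreover have "0 < r" "r < R" using r st m by auto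
        ultimately show "\<exists>y. (param has_real_derivative y) (at r) \<and> y < 0"
          using der[of r] mult_pos_neg by blast
      qed (rule st)
    qed
  qed fact+
qed

section \<open>Correspondence between scales and solutions\<close>

definition sol :: "real \<Rightarrow> real \<Rightarrow> real" where
  "sol b = restrict (\<lambda>x. w (b * \<bar>x\<bar>) / w b - 1) {-1..1}"

text \<open>The value at the centre, \<open>1 / w b - 1\<close>, determines \<open>b\<close> because
  \<open>w\<close> is strictly decreasing.\<close>

lemma sol_inj: "inj_on sol {0<..<R}"
proof (rule inj_onI)
  fix b c assume bc: "b \<in> {0<..<R}" "c \<in> {0<..<R}" "sol b = sol c"
  then have "sol b 0 = sol c 0" by simp
  then have "w b = w c" by (simp add: sol_def w_0)
  with bc w_less[of b c] w_less[of c b] show "b = c"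
    by (cases b c rule: linorder_cases) auto
qed

text \<open>Since \<open>b < R\<close>, all arguments \<open>b * \<bar>x\<bar>\<close> stay where
  \<open>w\<close> is positive. The extension lemmas give the derivatives across 0, scaling gives
  the equation, and the strict decrease of \<open>w\<close> gives positivity.\<close>

lemma sol_in_positive_even_solutions:
  assumes b: "0 < b" "b < R"
  shows "sol b \<in> positive_even_solutions l p (param b)"
proof -
  have wb: "0 < w b" using w_pos b by simp
  have bx: "b * \<bar>x\<bar> \<in> {0..<R}" if "\<bar>x\<bar> \<le> 1" for x
  proof -
    have "b * \<bar>x\<bar> \<le> b * 1" by (rule mult_left_mono) (use that b in auto)
    with b have "b * \<bar>x\<bar> < R" by linarith
    with b show ?thesis by simp
  qed
  have cont: "continuous_on {-1..1} (\<lambda>x. w (b * \<bar>x\<bar>))"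
  proof (rule continuous_on_compose2[OF w_cont])
    show "(\<lambda>x. b * \<bar>x\<bar>) ` {-1..1} \<subseteq> {0..R}"
      using bx by (force simp: abs_le_iff)
  qed (auto intro!: continuous_intros)
  then have "continuous_on {-1..1} (\<lambda>x. w (b * \<bar>x\<bar>) / w b - 1)"
    using wb by (intro continuous_intros) auto
  then have csol: "continuous_on {-1..1} (sol b)"
    by (rule continuous_on_eq) (simp add: sol_def)
  define u' where "u' x = b * (sgn (b * x) * w' \<bar>b * x\<bar>) / w b" for x
  define u'' where "u'' x = - (b * (b * (\<bar>b * x\<bar> powr l * w \<bar>b * x\<bar> powr p)) / w b)" for x
  have lt: "\<bar>b * x\<bar> < R" if "x \<in> {-1<..<1}" for x
    using bx[of x] that b by (auto simp: abs_mult)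
  have d1: "(sol b has_real_derivative u' x) (at x)" if x: "x \<in> {-1<..<1}" for x
  proof -
    have "((\<lambda>x. w \<bar>b * x\<bar>) has_real_derivative sgn (b * x) * w' \<bar>b * x\<bar> * b) (at x)"
      by (rule DERIV_chain2[OF even_extension_deriv[OF w_deriv w'_0 lt[OF x]] DERIV_cmult_Id])
    then have "((\<lambda>x. w \<bar>b * x\<bar> / w b - 1) has_real_derivative u' x) (at x)"
      unfolding u'_def using wb by (auto intro!: derivative_eq_intros)
    then show ?thesis
      by (rule has_field_derivative_transform_within_open[OF _ open_greaterThanLessThan x])
         (use b in \<open>auto simp: sol_def abs_mult\<close>)
  qed
  have d2: "(u' has_real_derivative u'' x) (at x)" if x: "x \<in> {-1<..<1}" for x
  proof -
    have "((\<lambda>x. sgn (b * x) * w' \<bar>b * x\<bar>) has_real_derivative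
        - (\<bar>b * x\<bar> powr l * w \<bar>b * x\<bar> powr p) * b) (at x)"
      by (rule DERIV_chain2[OF odd_extension_deriv[OF w'_deriv w'_0 lt[OF x]] DERIV_cmult_Id])
    from DERIV_cdivide[OF DERIV_cmult[OF this, of b], of "w b"] show ?thesis
      unfolding u'_def u''_def by (simp add: ac_simps)
  qed
  have eq: "u'' x + param b * \<bar>x\<bar> powr l * (sol b x + 1) powr p = 0"
    if x: "x \<in> {-1<..<1}" for x
  proof -
    have "0 \<le> w \<bar>b * x\<bar>" using lt[OF x] w_nonneg by simp
    then have "(sol b x + 1) powr p = w \<bar>b * x\<bar> powr p / w b powr p"
      using x b wb by (simp add: sol_def powr_divide abs_mult)
    moreover have "w b powr p = w b powr (p - 1) * w b" "b powr (l + 2) = b powr l * (b * b)"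
      using powr_add[of "w b" "p - 1" 1] powr_add[of b l 2] wb b by (simp_all add: power2_eq_square)
    moreover have "\<bar>b * x\<bar> powr l = b powr l * \<bar>x\<bar> powr l"
      using b by (simp add: abs_mult powr_mult)
    ultimately show ?thesis
      using wb by (simp add: u''_def param_def field_simps)
  qed
  have cont'': "continuous_on {-1<..<1} u''"
  proof -
    have *: "(\<lambda>x. w \<bar>b * x\<bar>) = (\<lambda>x. w (b * \<bar>x\<bar>))"
      using b by (simp add: abs_mult)
    have "continuous_on {-1<..<1} (\<lambda>x. w \<bar>b * x\<bar>)"
      unfolding * by (rule continuous_on_subset[OF cont]) auto
    then show ?thesis
      unfolding u''_def using l_pos p_gt_1 wb lt w_nonneg
      by (intro continuous_intros continuous_on_powr') (auto simp: less_imp_le)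
  qed
  have pos: "0 < sol b x" if "x \<in> {-1<..<1}" for x
  proof -
    have "b * \<bar>x\<bar> < b" using that b by auto
    then have "w b < w (b * \<bar>x\<bar>)" using w_less[of "b * \<bar>x\<bar>" b] b by simp
    then show ?thesis using that wb by (simp add: sol_def)
  qed
  have "sol b (-1) = 0" "sol b 1 = 0" using wb by (simp_all add: sol_def)
  with csol d1 d2 eq cont'' have "classical_solution l p (param b) (sol b)"
    unfolding classical_solution_def by blast
  with pos show ?thesis
    by (auto simp: positive_even_solutions_def positive_solution_def sol_def)
qed

text \<open>The scale \<open>b\<close> below is the one for which \<open>\<lambda>t. (u 0 + 1) * w (b * t)\<close> solves the same initial
  value problem as \<open>u + 1\<close>. If \<open>b \<ge> R\<close>, then \<open>u + 1\<close> would vanish at \<open>R / b \<le> 1\<close>.\<close>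

lemma positive_even_solution_is_sol:
  assumes "0 < lam" and u: "u \<in> positive_even_solutions l p lam"
  obtains b where "0 < b" "b < R" "param b = lam" "u = sol b"
proof -
  from u have ext: "u \<in> extensional {-1..1}" and contu: "continuous_on {-1..1} u"
    and even: "\<And>x. x \<in> {-1..1} \<Longrightarrow> u (- x) = u x" and u_pos: "\<And>x. x \<in> {-1<..<1} \<Longrightarrow> 0 < u x"
    and u1: "u 1 = 0"
    by (auto simp: positive_even_solutions_def positive_solution_def classical_solution_def)
  from u have "classical_solution l p lam u"
    by (simp add: positive_even_solutions_def positive_solution_def)
  then obtain u' u'' where d1: "\<And>x. x \<in> {-1<..<1} \<Longrightarrow> (u has_real_derivative u' x) (at x)"
    and d2: "\<And>x. x \<in> {-1<..<1} \<Longrightarrow> (u' has_real_derivative u'' x) (at x)"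
    and eq: "\<And>x. x \<in> {-1<..<1} \<Longrightarrow> u'' x + lam * \<bar>x\<bar> powr l * (u x + 1) powr p = 0"
    unfolding classical_solution_def by blast
  \<comment> \<open>By evenness the derivative at 0 equals its own negative.\<close>
  have "u' 0 = 0"
  proof -
    have "((\<lambda>x. u (- x)) has_real_derivative u' 0 * - 1) (at 0)"
      by (rule DERIV_chain2[where f = u]) (use d1[of 0] in \<open>auto intro!: derivative_eq_intros\<close>)
    then have "(u has_real_derivative u' 0 * - 1) (at 0)"
      by (rule has_field_derivative_transform_within_open[where S = "{-1<..<1}"])
         (auto simp: even)
    with d1[of 0] have "u' 0 = u' 0 * - 1" by (intro DERIV_unique) auto
    then show ?thesis by simp
  qed
  define a where "a = u 0 + 1"
  have "1 < a" using u_pos[of 0] by (simp add: a_def)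
  define b where "b = (lam * a powr (p - 1)) powr (1 / (l + 2))"
  have "0 < b" using \<open>0 < lam\<close> \<open>1 < a\<close> by (simp add: b_def)
  have b_powr: "b powr (l + 2) = lam * a powr (p - 1)"
    using \<open>0 < lam\<close> \<open>1 < a\<close> l_pos by (simp add: b_def powr_powr)
  have a_powr: "a powr p = a powr (p - 1) * a"
    using powr_add[of a "p - 1" 1] \<open>1 < a\<close> by simp
  \<comment> \<open>This matches coefficients: the left side comes from differentiating
    \<open>a * w (b * s)\<close> twice, the right side from inserting it into the
    nonlinearity.\<close>
  have scale: "a * (b * (b * b powr l)) = lam * a powr p"
    using powr_add[of b l 2] b_powr \<open>0 < b\<close> by (simp add: a_powr power2_eq_square ac_simps)
  \<comment> \<open>The comparison runs as far as both functions are available: \<open>u\<close> up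
    to 1, the rescaled profile up to \<open>R / b\<close>.\<close>
  define c where "c = min 1 (R / b)"
  have c: "0 < c" "c \<le> 1" "b * c \<le> R" using R_pos \<open>0 < b\<close> by (auto simp: c_def min_def field_simps)
  have bt: "b * t \<le> R" if "t \<le> c" for t
    using mult_left_mono[OF that, of b] c \<open>0 < b\<close> by linarith
  have bt': "b * t < R" if "t < c" for t
    using mult_strict_left_mono[OF that, of b] c \<open>0 < b\<close> by linarith
  define D where "D t = u t + 1 - a * w (b * t)" for t
  have contD: "continuous_on {0..c} D"
  proof -
    have "continuous_on {0..c} (\<lambda>t. w (b * t))"
    proof (rule continuous_on_compose2[OF w_cont])
      show "(\<lambda>t. b * t) ` {0..c} \<subseteq> {0..R}" using bt \<open>0 < b\<close> by auto
    qed (intro continuous_intros)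
    moreover have "continuous_on {0..c} u"
      using c by (intro continuous_on_subset[OF contu]) auto
    ultimately show ?thesis unfolding D_def by (intro continuous_intros)
  qed
  have "bounded (u ` {-1..1})"
    using contu by (intro compact_imp_bounded compact_continuous_image) auto
  then obtain B where B: "\<And>x. x \<in> {-1..1} \<Longrightarrow> \<bar>u x\<bar> \<le> B"
    unfolding bounded_iff real_norm_def by blast
  \<comment> \<open>\<open>M\<close> bounds \<open>u + 1\<close>, in particular \<open>a\<close>,
    and hence \<open>a * w (b * s)\<close>; one Lipschitz constant serves both arguments.\<close>
  define M where "M = B + 1"
  have uM: "u x + 1 \<le> M" if "x \<in> {-1..1}" for x
    using B[OF that] by (simp add: M_def)
  define D1 where "D1 s = u' s - a * (b * w' (b * s))" for s
  define D2 where "D2 s = u'' s + a * (b * (b * ((b * s) powr l * w (b * s) powr p)))" for s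
  \<comment> \<open>Stopping before \<open>c\<close> keeps \<open>{0..t}\<close> inside the open
    interval, where \<open>u'\<close> is continuous; nothing is known about \<open>u'\<close> at
    1.\<close>
  have D_eq_0: "D t = 0" if t: "t \<in> {0..<c}" for t
  proof (rule second_order_zero_unique[where b = t and D' = D1 and D'' = D2 and D = D])
    show "t \<in> {0..t}" using t by simp
    have sub: "b * s \<in> {0..<R}" "s \<in> {-1<..<1}" if "s \<in> {0..t}" for s
    proof -
      have "0 \<le> s" "s < c" using that t by auto
      then show "b * s \<in> {0..<R}" "s \<in> {-1<..<1}"
        using bt'[of s] \<open>0 < b\<close> c by simp_all
    qed
    have "continuous_on {0..t} u'"
      by (rule DERIV_continuous_on, rule has_field_derivative_at_within, rule d2[OF sub(2)])
    moreover have "continuous_on {0..t} (\<lambda>s. w' (b * s))"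
    proof (rule continuous_on_compose2[OF DERIV_continuous_on[OF w'_deriv]])
      show "(\<lambda>s. b * s) ` {0..t} \<subseteq> {0..R}"
        using sub(1) by (intro image_subsetI) (simp add: less_imp_le)
    qed (auto intro!: continuous_intros)
    ultimately show "continuous_on {0..t} D1"
      unfolding D1_def by (intro continuous_intros)
    show "continuous_on {0..t} D"
      using t by (intro continuous_on_subset[OF contD]) auto
    show "D 0 = 0" by (simp add: D_def w_0 a_def)
    show "D1 0 = 0" by (simp add: D1_def \<open>u' 0 = 0\<close> w'_0)
    fix s assume s: "0 < s" "s < t"
    then have st: "s \<in> {0..t}" by simp
    have bs: "0 < b * s" "b * s < R" using s sub(1)[OF st] \<open>0 < b\<close> by auto
    have dw: "(w has_real_derivative w' (b * s)) (at (b * s))"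
      using w_deriv[of "b * s"] bs by (simp add: at_within_Icc_at)
    have dw': "(w' has_real_derivative - ((b * s) powr l * w (b * s) powr p)) (at (b * s))"
      using w'_deriv[of "b * s"] bs by (simp add: at_within_Icc_at)
    show "(D has_real_derivative D1 s) (at s)"
      unfolding D_def D1_def using d1[OF sub(2)[OF st]] DERIV_chain2[OF dw DERIV_cmult_Id]
      by (auto intro!: derivative_eq_intros)
    show "(D1 has_real_derivative D2 s) (at s)"
      unfolding D1_def D2_def using d2[OF sub(2)[OF st]] DERIV_chain2[OF dw' DERIV_cmult_Id]
      by (auto intro!: derivative_eq_intros)
    have wbs: "0 < w (b * s)" "w (b * s) \<le> 1" using w_pos w_le_1 bs by auto
    have "a * (b * (b * ((b * s) powr l * w (b * s) powr p)))
        = a * (b * (b * b powr l)) * s powr l * w (b * s) powr p"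
      using s \<open>0 < b\<close> by (simp add: powr_mult)
    also have "\<dots> = lam * s powr l * (a * w (b * s)) powr p"
      unfolding scale using \<open>1 < a\<close> wbs by (simp add: powr_mult)
    finally have "D2 s = - (lam * s powr l * ((u s + 1) powr p - (a * w (b * s)) powr p))"
      using eq[OF sub(2)[OF st]] s by (simp add: D2_def algebra_simps)
    then have "\<bar>D2 s\<bar> = lam * s powr l * \<bar>(u s + 1) powr p - (a * w (b * s)) powr p\<bar>"
      using \<open>0 < lam\<close> by (simp add: abs_mult)
    also have "\<dots> \<le> lam * 1 * (p * M powr (p - 1) * \<bar>(u s + 1) - a * w (b * s)\<bar>)"
    proof (intro mult_mono powr_lipschitz_on_Icc)
      show "s powr l \<le> 1" using s t c l_pos by (intro powr_le1) auto
      have "a * w (b * s) \<le> a" using wbs \<open>1 < a\<close> by simp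
      also have "a \<le> M" using uM[of 0] by (simp add: a_def)
      finally show "a * w (b * s) \<in> {0..M}" using wbs \<open>1 < a\<close> by simp
      show "u s + 1 \<in> {0..M}" using uM[of s] u_pos[of s] sub(2)[OF st] by auto
    qed (use \<open>0 < lam\<close> p_gt_1 in auto)
    finally show "\<bar>D2 s\<bar> \<le> (lam * (p * M powr (p - 1))) * \<bar>D s\<bar>"
      by (simp add: D_def ac_simps)
  qed
  \<comment> \<open>Continuity carries the equality to \<open>c\<close>, where the boundary value of
    \<open>u\<close> can enter.\<close>
  have D_c: "D t = 0" if "t \<in> {0..c}" for t
    using continuous_constant_on_closure[of "{0..<c}" D 0 t] contD D_eq_0 that c by simp
  have "b < R"
  proof (rule ccontr)
    assume "\<not> b < R"
    then have "c = R / b" using \<open>0 < b\<close> by (simp add: c_def min_def field_simps)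
    then have "b * c = R" using \<open>0 < b\<close> by simp
    with D_c[of c] c have "u c + 1 = 0" by (simp add: D_def w_R)
    moreover have "0 \<le> u c" using u_pos[of c] u1 c by (cases "c = 1") auto
    ultimately show False by simp
  qed
  then have "c = 1" using \<open>0 < b\<close> by (simp add: c_def min_def field_simps)
  \<comment> \<open>The boundary condition becomes the normalisation \<open>a * w b = 1\<close>,
    which identifies both \<open>param b\<close> with \<open>lam\<close> and \<open>u\<close> with
    \<open>sol b\<close>.\<close>
  with D_c[of 1] u1 have aw: "a * w b = 1" by (simp add: D_def)
  have wb: "0 < w b" using w_pos \<open>0 < b\<close> \<open>b < R\<close> by simp
  show thesis
  proof
    have "param b = lam * (a * w b) powr (p - 1)"
      using wb \<open>1 < a\<close> by (simp add: param_def b_powr powr_mult)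
    then show "param b = lam" by (simp add: aw)
    have "u x = sol b x" for x
    proof (cases "x \<in> {-1..1}")
      case True
      then have "u x = u \<bar>x\<bar>" using even[of x] by (simp add: abs_if)
      also have "\<dots> = a * w (b * \<bar>x\<bar>) - 1"
      proof -
        have "\<bar>x\<bar> \<in> {0..c}" using True \<open>c = 1\<close> by auto
        from D_c[OF this] show ?thesis by (simp add: D_def)
      qed
      also have "a = 1 / w b" using aw wb by (simp add: field_simps)
      finally show ?thesis using True by (simp add: sol_def)
    next
      case False
      have "u x = undefined" using ext False by (rule extensional_arb)
      moreover have "sol b x = undefined" unfolding sol_def restrict_def using False by (rule if_not_P)
      ultimately show ?thesis by simp
    qed
    then show "u = sol b" by blast
  qed fact+
qed

lemma positive_even_solutions_eq:
  assumes "0 < lam"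
  shows "positive_even_solutions l p lam = sol ` {b \<in> {0<..<R}. param b = lam}"
proof (intro subset_antisym subsetI)
  fix u assume "u \<in> positive_even_solutions l p lam"
  then obtain b where "0 < b" "b < R" "param b = lam" "u = sol b"
    using positive_even_solution_is_sol[OF assms] by blast
  then show "u \<in> sol ` {b \<in> {0<..<R}. param b = lam}" by auto
next
  fix u assume "u \<in> sol ` {b \<in> {0<..<R}. param b = lam}"
  then show "u \<in> positive_even_solutions l p lam"
    using sol_in_positive_even_solutions by auto
qed

end

section \<open>Counting solutions through the level sets of the parameter\<close>

theorem proposition1p2:
  fixes l p :: real
  assumes "l > 0" and "p > 1"
  shows "\<exists>lam_star>0.
    (\<forall>lam. 0 < lam \<and> lam < lam_star \<longrightarrow> card (positive_even_solutions l p lam) = 2) \<and>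
    (\<exists>!u. u \<in> positive_even_solutions l p lam_star) \<and>
    (\<forall>lam>lam_star. positive_even_solutions l p lam = {})"
proof -
  obtain R w w' where "emden_profile l p R w w'"
    using emden_profile_exists[OF assms] by blast
  then interpret emden_profile l p R w w' .
  obtain m where m: "0 < m" "m < R" "strict_mono_on {0..m} param" "strict_antimono_on {m..R} param"
    using param_unimodal .
  have "param 0 = 0" "param R = 0"
    using l_pos p_gt_1 by (simp_all add: param_def w_R)
  \<comment> \<open>As both end values vanish, the end conditions reduce to positivity of the
    level.\<close>
  note level = unimodal_level_sets[OF param_cont m(1,2), unfolded this, OF _ _ m(3,4)]
  have pos: "0 < param m"
    using m w_pos[of m] by (simp add: param_def)
  show ?thesis
  proof (intro exI[of _ "param m"] conjI allI impI)
    show "0 < param m" by (rule pos)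
    show "card (positive_even_solutions l p lam) = 2" if "0 < lam \<and> lam < param m" for lam
    proof -
      \<comment> \<open>Injectivity turns the count of scales into the count of solutions.\<close>
      have "inj_on sol {b \<in> {0<..<R}. param b = lam}"
        by (rule inj_on_subset[OF sol_inj]) auto
      with that level(1)[of lam] show ?thesis
        by (simp add: positive_even_solutions_eq card_image)
    qed
    show "\<exists>!u. u \<in> positive_even_solutions l p (param m)"
      using level(2)[of "param m"] pos by (simp add: positive_even_solutions_eq)
    show "positive_even_solutions l p lam = {}" if "param m < lam" for lam
      using level(3)[of lam] pos that by (simp add: positive_even_solutions_eq)
  qed
qed

end
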